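(* Let $n\ge1$. For any symbol $a\in L^\infty(\mathrm{D}^{\mathrm{I}}_{n\times n})$, the following properties hold. (1) If $a(Z)=a\big((Z^*Z)^{\frac12}\big)$ for every $Z\in\mathrm{D}^{\mathrm{I}}_{n\times n}$, then $a$ is $\mathrm{U}(n)_L$-invariant. Conversely, if $a$ is $\mathrm{U}(n)_L$-invariant, then $a(Z)=a\big((Z^*Z)^{\frac12}\big)$ for every $Z\in\mathrm{D}^{\mathrm{I}}_{n\times n}\cap\mathrm{GL}(n,\mathbb{C})$. (2) If $a(Z)=a\big((ZZ^* )^{\frac12}\big)$ for every $Z\in\mathrm{D}^{\mathrm{I}}_{n\times n}$, then $a$ is $\mathrm{U}(n)_R$-invariant. Conversely, if $a$ is $\mathrm{U}(n)_R$-invariant, then $a(Z)=a\big((ZZ^* )^{\frac12}\big)$ for every $Z\in\mathrm{D}^{\mathrm{I}}_{n\times n}\cap\mathrm{GL}(n,\mathbb{C})$.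
   Context: $\mathrm{D}^{\mathrm{I}}_{n\times n}=\{Z\in M_{n\times n}(\mathbb{C}): Z^*Z<I_n\}$. Here a symbol $a$ is a measurable, essentially bounded function defined at every point of $\mathrm{D}^{\mathrm{I}}_{n\times n}$, and the identities are pointwise. $a$ is $\mathrm{U}(n)_L$-invariant (left $\mathrm{U}(n)$-invariant) if $a(UZ)=a(Z)$ for every $U\in\mathrm{U}(n)$ and $Z\in\mathrm{D}^{\mathrm{I}}_{n\times n}$, and $\mathrm{U}(n)_R$-invariant (right $\mathrm{U}(n)$-invariant) if $a(ZV)=a(Z)$ for every $V\in\mathrm{U}(n)$ and $Z\in\mathrm{D}^{\mathrm{I}}_{n\times n}$. *)

theory Defs
  imports "HOL-Analysis.Analysis"
begin

definition conj_transpose :: "complex^'n^'m \<Rightarrow> complex^'m^'n" where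
  "conj_transpose A = (\<chi> i j. cnj (A $ j $ i))"

definition hermitian_mat :: "complex^'n^'n \<Rightarrow> bool" where
  "hermitian_mat A \<longleftrightarrow> conj_transpose A = A"

text \<open>The value \<open>x\<^sup>* A x\<close>; it is real if \<open>A\<close> is Hermitian.\<close>

definition quad_form :: "complex^'n^'n \<Rightarrow> complex^'n \<Rightarrow> complex" where
  "quad_form A x = (\<Sum>i\<in>UNIV. cnj (x $ i) * (A *v x) $ i)"

definition pos_semidef :: "complex^'n^'n \<Rightarrow> bool" where
  "pos_semidef A \<longleftrightarrow> hermitian_mat A \<and> (\<forall>x. 0 \<le> Re (quad_form A x))"

definition pos_def :: "complex^'n^'n \<Rightarrow> bool" where
  "pos_def A \<longleftrightarrow> hermitian_mat A \<and> (\<forall>x. x \<noteq> 0 \<longrightarrow> 0 < Re (quad_form A x))"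

text \<open>The strict Loewner order. The library's \<open><\<close> on vectors is componentwise and is not
  what is meant by \<open>Z\<^sup>* Z < I\<close>.\<close>

definition loewner_less :: "complex^'n^'n \<Rightarrow> complex^'n^'n \<Rightarrow> bool" where
  "loewner_less A B \<longleftrightarrow> pos_def (B - A)"

text \<open>The unique positive semidefinite square root of a positive semidefinite matrix;
  unspecified for other arguments.\<close>

definition psd_sqrt :: "complex^'n^'n \<Rightarrow> complex^'n^'n" where
  "psd_sqrt A = (THE B. pos_semidef B \<and> B ** B = A)"

definition unitary_group :: "(complex^'n^'n) set" where
  "unitary_group = {U. conj_transpose U ** U = mat 1 \<and> U ** conj_transpose U = mat 1}"

definition general_linear :: "(complex^'n^'n) set" where
  "general_linear = {Z. invertible Z}"

definition cartan_domain_I :: "(complex^'n^'n) set" where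
  "cartan_domain_I = {Z. loewner_less (conj_transpose Z ** Z) (mat 1)}"

text \<open>Symbols are functions rather than classes modulo null sets. They are total only for
  typing reasons: values outside the domain play no role.\<close>

definition Linf_symbol :: "(complex^'n^'n \<Rightarrow> complex) \<Rightarrow> bool" where
  "Linf_symbol a \<longleftrightarrow>
     a \<in> borel_measurable (lebesgue_on cartan_domain_I) \<and>
     (\<exists>C::real. AE Z in lebesgue_on cartan_domain_I. norm (a Z) \<le> C)"

definition left_unitary_invariant :: "(complex^'n^'n \<Rightarrow> complex) \<Rightarrow> bool" where
  "left_unitary_invariant a \<longleftrightarrow>
     (\<forall>U\<in>unitary_group. \<forall>Z\<in>cartan_domain_I. a (U ** Z) = a Z)"

definition right_unitary_invariant :: "(complex^'n^'n \<Rightarrow> complex) \<Rightarrow> bool" where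
  "right_unitary_invariant a \<longleftrightarrow>
     (\<forall>V\<in>unitary_group. \<forall>Z\<in>cartan_domain_I. a (Z ** V) = a Z)"

end

theory Submission
  imports Defs
begin

text \<open>
  Everything rests on the polar decomposition in the following form: for every square matrix
  \<open>Z\<close> there are unitary \<open>U\<close> and \<open>V\<close> with \<open>(Z\<^sup>* Z)\<^sup>\<onehalf> = U Z\<close> and
  \<open>(Z Z\<^sup>*)\<^sup>\<onehalf> = Z V\<close> (\<open>psd_sqrt_gram_left\<close>, \<open>psd_sqrt_gram_right\<close>). An invariant symbol
  therefore cannot distinguish \<open>Z\<close> from the corresponding square root. In the other direction,
  \<open>Z\<^sup>* Z\<close> does not change when \<open>Z\<close> is multiplied by a unitary matrix on the left, nor does
  \<open>Z Z\<^sup>*\<close> when it is multiplied on the right; and the domain is stable under both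
  multiplications. So a symbol that factors through one of the square roots is invariant.

  The polar decomposition is obtained without diagonalising anything
  (\<open>unitary_polar_factor\<close>). The unitary group is compact, so \<open>Re tr (U\<^sup>* Z)\<close> attains its
  maximum at some unitary \<open>U\<close>. Put \<open>P = U\<^sup>* Z\<close>; then \<open>Re tr (W P) \<le> Re tr P\<close> for all unitary
  \<open>W\<close>. Rotating a single direction \<open>x\<close> by a phase \<open>\<omega>\<close> gives \<open>Re (\<omega> q) \<le> Re q\<close> for
  \<open>q = x\<^sup>* P x\<close>, and the phase with \<open>\<omega> q = \<bar>q\<bar>\<close> shows that \<open>q\<close> is real and nonnegative. Hence
  \<open>P\<close> is positive semidefinite, and \<open>P P = P\<^sup>* P = Z\<^sup>* Z\<close>.

  Since the square root is defined by a definite description, \<open>P\<close> has to be the only positive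
  semidefinite root (\<open>pos_semidef_sqrt_unique\<close>). If \<open>Q\<close> is another one, then \<open>D = P - Q\<close>
  anticommutes with \<open>P + Q\<close>, so \<open>tr (D P D) + tr (D Q D)\<close> equals its own negative. Both
  traces are nonnegative, hence both vanish; this forces \<open>P D = Q D = 0\<close>, so \<open>D\<^sup>* D = D D = 0\<close>
  and \<open>D = 0\<close>.
\<close>

section \<open>Conjugate transposes and quadratic forms\<close>

lemma conj_transpose_conj_transpose [simp]: "conj_transpose (conj_transpose A) = A"
  by (simp add: conj_transpose_def vec_eq_iff)

lemma conj_transpose_mult: "conj_transpose (A ** B) = conj_transpose B ** conj_transpose A"
  by (simp add: conj_transpose_def matrix_matrix_mult_def vec_eq_iff mult.commute)

lemma conj_transpose_mat_1 [simp]: "conj_transpose (mat 1) = mat 1"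
  by (simp add: conj_transpose_def mat_def vec_eq_iff)

lemma conj_transpose_diff: "conj_transpose (A - B) = conj_transpose A - conj_transpose B"
  by (simp add: conj_transpose_def vec_eq_iff)

lemma matrix_add_rdistrib: "((A :: complex^'n^'m) + B) ** C = A ** C + B ** C"
  by (simp add: matrix_matrix_mult_def vec_eq_iff distrib_right sum.distrib)

lemma matrix_diff_ldistrib: "(A :: complex^'n^'m) ** (B - C) = A ** B - A ** C"
  by (simp add: matrix_matrix_mult_def vec_eq_iff right_diff_distrib sum_subtractf)

lemma matrix_diff_rdistrib: "((A :: complex^'n^'m) - B) ** C = A ** C - B ** C"
  by (simp add: matrix_matrix_mult_def vec_eq_iff left_diff_distrib sum_subtractf)

lemma quad_form_eq_sum: "quad_form A x = (\<Sum>i\<in>UNIV. \<Sum>j\<in>UNIV. cnj (x $ i) * A $ i $ j * x $ j)"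
  by (simp add: quad_form_def matrix_vector_mult_def sum_distrib_left mult.assoc)

lemma conj_transpose_adjoint:
  "(\<Sum>i\<in>UNIV. cnj (x $ i) * (conj_transpose V *v y) $ i) = (\<Sum>k\<in>UNIV. cnj ((V *v x) $ k) * y $ k)"
proof -
  have "(\<Sum>i\<in>UNIV. cnj (x $ i) * (conj_transpose V *v y) $ i)
      = (\<Sum>i\<in>UNIV. \<Sum>k\<in>UNIV. cnj (x $ i) * (cnj (V $ k $ i) * y $ k))"
    by (simp add: matrix_vector_mult_def conj_transpose_def sum_distrib_left)
  also have "\<dots> = (\<Sum>k\<in>UNIV. \<Sum>i\<in>UNIV. cnj (x $ i) * (cnj (V $ k $ i) * y $ k))"
    by (rule sum.swap)
  also have "\<dots> = (\<Sum>k\<in>UNIV. cnj ((V *v x) $ k) * y $ k)"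
    by (simp add: matrix_vector_mult_def sum_distrib_right sum_distrib_left mult_ac)
  finally show ?thesis .
qed

lemma quad_form_congruence: "quad_form (conj_transpose V ** A ** V) x = quad_form A (V *v x)"
  by (simp add: quad_form_def conj_transpose_adjoint flip: matrix_vector_mul_assoc)

lemma trace_conj_transpose_mult_mult:
  "trace (conj_transpose D ** P ** D) = (\<Sum>j\<in>UNIV. quad_form P (column j D))"
proof -
  have "(conj_transpose D ** P ** D) $ j $ j = quad_form P (column j D)" for j
    unfolding quad_form_eq_sum
    by (subst sum.swap)
      (simp add: matrix_matrix_mult_def conj_transpose_def column_def sum_distrib_right)
  then show ?thesis by (simp add: trace_def)
qed

text \<open>This identifies the ambient Euclidean structure with the Frobenius inner product, so that
  norm bounds and continuity of \<open>Re tr (A\<^sup>* B)\<close> come for free.\<close>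

lemma inner_eq_Re_trace: "A \<bullet> B = Re (trace (conj_transpose A ** B))"
  for A B :: "complex^'n^'n"
proof -
  have "A \<bullet> B = (\<Sum>i\<in>UNIV. \<Sum>j\<in>UNIV. Re (cnj (A $ i $ j) * B $ i $ j))"
    by (simp add: inner_vec_def inner_complex_def)
  also have "\<dots> = (\<Sum>j\<in>UNIV. \<Sum>i\<in>UNIV. Re (cnj (A $ i $ j) * B $ i $ j))"
    by (rule sum.swap)
  finally show ?thesis
    by (simp add: trace_def matrix_matrix_mult_def conj_transpose_def)
qed

lemma conj_transpose_mult_eq_0:
  fixes D :: "complex^'n^'n"
  assumes "conj_transpose D ** D = 0"
  shows "D = 0"
  using assms inner_eq_Re_trace[of D D] by (simp add: trace_def)

lemma quad_form_axis_add_axis: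
  "quad_form P (axis k 1 + c *s axis l 1)
     = P $ k $ k + c * P $ k $ l + cnj c * P $ l $ k + cnj c * c * P $ l $ l"
proof -
  have col: "(P *v axis m 1) $ i = P $ i $ m" for m i
    by (simp add: matrix_vector_mult_def axis_def if_distrib[of "\<lambda>z. _ * z"] cong: if_cong)
  have "quad_form P (axis k 1 + c *s axis l 1)
      = (\<Sum>i\<in>UNIV. cnj ((axis k 1 + c *s axis l 1) $ i) * (P $ i $ k + c * P $ i $ l))"
    by (simp add: quad_form_def matrix_vector_right_distrib vector_scalar_commute col)
  also have "\<dots> = (\<Sum>i\<in>UNIV. (if i = k then P $ i $ k + c * P $ i $ l else 0)
        + (if i = l then cnj c * (P $ i $ k + c * P $ i $ l) else 0))"
    by (intro sum.cong) (auto simp: axis_def algebra_simps)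
  also have "\<dots> = P $ k $ k + c * P $ k $ l + cnj c * P $ l $ k + cnj c * c * P $ l $ l"
    by (simp add: sum.distrib algebra_simps)
  finally show ?thesis .
qed

text \<open>Polarization: the vectors \<open>e\<^sub>k + e\<^sub>l\<close> and \<open>e\<^sub>k + \<i> e\<^sub>l\<close> give the imaginary and the real part
  of \<open>P\<^sub>k\<^sub>l = cnj P\<^sub>l\<^sub>k\<close>.\<close>

lemma hermitian_mat_if_quad_form_real:
  assumes "\<And>x. quad_form P x \<in> \<real>"
  shows "hermitian_mat P"
proof -
  have diag: "P $ k $ k \<in> \<real>" for k
    using assms[of "axis k 1 + 0 *s axis k 1"] unfolding quad_form_axis_add_axis by simp
  have "cnj (P $ l $ k) = P $ k $ l" for k l
  proof -
    have "P $ k $ l + P $ l $ k \<in> \<real>"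
      using assms[of "axis k 1 + 1 *s axis l 1"] diag[of k] diag[of l]
      unfolding quad_form_axis_add_axis by (simp add: complex_is_Real_iff)
    moreover have "\<i> * P $ k $ l - \<i> * P $ l $ k \<in> \<real>"
      using assms[of "axis k 1 + \<i> *s axis l 1"] diag[of k] diag[of l]
      unfolding quad_form_axis_add_axis by (simp add: complex_is_Real_iff)
    ultimately show ?thesis
      by (simp add: complex_is_Real_iff complex_eq_iff)
  qed
  then show ?thesis
    by (simp add: hermitian_mat_def conj_transpose_def vec_eq_iff)
qed

section \<open>Unitary matrices\<close>

lemma unitary_groupI:
  assumes "conj_transpose U ** U = mat 1"
  shows "U \<in> unitary_group"
  using assms matrix_left_right_inverse by (auto simp: unitary_group_def)

lemma conj_transpose_in_unitary_group: "U \<in> unitary_group \<Longrightarrow> conj_transpose U \<in> unitary_group"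
  by (simp add: unitary_group_def)

lemma unitary_group_mult:
  assumes "U \<in> unitary_group" "V \<in> unitary_group"
  shows "U ** V \<in> unitary_group"
proof (rule unitary_groupI)
  have "conj_transpose (U ** V) ** (U ** V)
      = conj_transpose V ** (conj_transpose U ** U) ** V"
    by (simp add: conj_transpose_mult matrix_mul_assoc)
  then show "conj_transpose (U ** V) ** (U ** V) = mat 1"
    using assms by (simp add: unitary_group_def)
qed

lemma compact_unitary_group: "compact (unitary_group :: (complex^'n^'n) set)"
proof (rule compact_eq_bounded_closed[THEN iffD2], rule conjI)
  have "norm U \<le> sqrt CARD('n)" if "U \<in> unitary_group" for U :: "complex^'n^'n"
    using that inner_eq_Re_trace[of U U]
    by (simp add: norm_eq_sqrt_inner unitary_group_def trace_def mat_def)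
  then show "bounded (unitary_group :: (complex^'n^'n) set)"
    by (auto simp: bounded_iff)
  show "closed (unitary_group :: (complex^'n^'n) set)"
    unfolding unitary_group_def conj_transpose_def matrix_matrix_mult_def
    by (intro closed_Collect_conj closed_Collect_eq continuous_intros)
qed

text \<open>The matrix \<open>W\<close> multiplies \<open>x\<close> by the phase \<open>\<omega>\<close> and fixes the orthogonal complement of
  \<open>x\<close>. These are the competitors in the maximisation of the trace: they detect the
  quadratic form at the single vector \<open>x\<close>.\<close>

lemma rank_one_perturbation_unitary:
  fixes x :: "complex^'n"
  assumes "x \<noteq> 0" and "norm \<omega> = 1"
  defines "c \<equiv> (\<omega> - 1) / complex_of_real ((norm x)\<^sup>2)"
  defines "W \<equiv> mat 1 + (\<chi> i j. c * x $ i * cnj (x $ j))"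
  shows "W \<in> unitary_group"
    and "trace (W ** P) = trace P + c * quad_form P x"
proof -
  define s where "s = complex_of_real ((norm x)\<^sup>2)"
  have s: "(\<Sum>k\<in>UNIV. x $ k * cnj (x $ k)) = s"
    unfolding s_def power2_norm_eq_inner
    by (simp add: inner_vec_def complex_mult_cnj inner_complex_def power2_eq_square)
  have "s \<noteq> 0" using assms(1) by (simp add: s_def)
  have cs: "c * s = \<omega> - 1" using \<open>s \<noteq> 0\<close> by (simp add: c_def s_def)
  have "cnj s = s" by (simp add: s_def)
  \<comment> \<open>The coefficient of \<open>x x\<^sup>*\<close> in \<open>W\<^sup>* W\<close> is \<open>c + cnj c + c cnj c s\<close>; after multiplication by
    \<open>s\<close> it becomes \<open>\<omega> cnj \<omega> - 1\<close>.\<close>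
  have "\<omega> * cnj \<omega> = 1" using assms(2) by (simp add: complex_norm_square[symmetric])
  moreover have "cnj c * s = cnj \<omega> - 1"
    using arg_cong[OF cs, of cnj] \<open>cnj s = s\<close> by simp
  ultimately have "s * (c + cnj c + c * cnj c * s) = 0"
    using cs by algebra
  then have c: "c + cnj c + c * cnj c * s = 0" using \<open>s \<noteq> 0\<close> by simp
  have "(conj_transpose W ** W) $ i $ j = (mat 1 :: complex^'n^'n) $ i $ j" for i j
  proof -
    have "(conj_transpose W ** W) $ i $ j
       = (\<Sum>k\<in>UNIV. ((if k = i then 1 else 0) + cnj c * cnj (x $ k) * x $ i)
          * ((if k = j then 1 else 0) + c * x $ k * cnj (x $ j)))"
      unfolding W_def
      by (auto simp: matrix_matrix_mult_def conj_transpose_def mat_def intro!: sum.cong)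
    also have "\<dots> = (\<Sum>k\<in>UNIV. (if k = i then (if i = j then 1 else 0) + c * x $ i * cnj (x $ j) else 0)
        + (if k = j then cnj c * cnj (x $ j) * x $ i else 0)
        + c * cnj c * x $ i * cnj (x $ j) * (x $ k * cnj (x $ k)))"
      by (intro sum.cong) (auto simp: algebra_simps)
    also have "\<dots> = (if i = j then 1 else 0) + (c + cnj c + c * cnj c * s) * (x $ i * cnj (x $ j))"
      by (simp add: sum.distrib s flip: sum_distrib_left) (simp add: algebra_simps)
    finally show ?thesis by (simp add: c mat_def)
  qed
  then show "W \<in> unitary_group"
    by (intro unitary_groupI) (simp add: vec_eq_iff)
  have "trace (W ** P) = trace P + trace ((\<chi> i j. c * x $ i * cnj (x $ j)) ** P)"
    unfolding W_def by (simp add: matrix_add_rdistrib trace_add)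
  also have "trace ((\<chi> i j. c * x $ i * cnj (x $ j)) ** P)
      = (\<Sum>i\<in>UNIV. \<Sum>j\<in>UNIV. c * (cnj (x $ j) * P $ j $ i * x $ i))"
    by (simp add: trace_def matrix_matrix_mult_def mult_ac)
  also have "\<dots> = c * quad_form P x"
    by (subst sum.swap) (simp add: quad_form_eq_sum sum_distrib_left)
  finally show "trace (W ** P) = trace P + c * quad_form P x" .
qed

section \<open>Polar decomposition\<close>

text \<open>A maximiser of \<open>Re tr (U\<^sup>* Z)\<close> over the unitary group has the required property, because
  no rotation of a single direction can increase the trace of \<open>U\<^sup>* Z\<close>.\<close>

lemma unitary_polar_factor:
  fixes Z :: "complex^'n^'n"
  obtains U where "U \<in> unitary_group" and "pos_semidef (conj_transpose U ** Z)"
proof -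
  have "mat 1 \<in> (unitary_group :: (complex^'n^'n) set)"
    by (simp add: unitary_group_def)
  then have "\<exists>U\<in>unitary_group. \<forall>V\<in>unitary_group. V \<bullet> Z \<le> U \<bullet> Z"
    by (intro continuous_attains_sup compact_unitary_group continuous_intros) auto
  then obtain U where U: "U \<in> unitary_group"
    and max: "\<And>V. V \<in> unitary_group \<Longrightarrow> V \<bullet> Z \<le> U \<bullet> Z"
    by blast
  define P where "P = conj_transpose U ** Z"
  have trace_max: "Re (trace (W ** P)) \<le> Re (trace P)" if "W \<in> unitary_group" for W
    using max[OF unitary_group_mult[OF U conj_transpose_in_unitary_group[OF that]]]
    by (simp add: inner_eq_Re_trace conj_transpose_mult matrix_mul_assoc P_def)
  have quad: "norm (quad_form P x) \<le> Re (quad_form P x)" for x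
  proof (cases "quad_form P x = 0 \<or> x = 0")
    case False
    define q where "q = quad_form P x"
    \<comment> \<open>The phase that turns \<open>q\<close> into \<open>\<bar>q\<bar>\<close>.\<close>
    define \<omega> where "\<omega> = cnj q / norm q"
    have "q \<noteq> 0" "x \<noteq> 0" using False by (auto simp: q_def)
    then have \<omega>: "norm \<omega> = 1" by (simp add: \<omega>_def norm_divide)
    have "Re ((\<omega> - 1) / complex_of_real ((norm x)\<^sup>2) * q) \<le> 0"
      using trace_max[OF rank_one_perturbation_unitary(1)[OF \<open>x \<noteq> 0\<close> \<omega>]]
      unfolding rank_one_perturbation_unitary(2)[OF \<open>x \<noteq> 0\<close> \<omega>] q_def by simp
    also have "(\<omega> - 1) / complex_of_real ((norm x)\<^sup>2) * q
        = (\<omega> - 1) * q / complex_of_real ((norm x)\<^sup>2)" by simp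
    finally have "Re ((\<omega> - 1) * q) \<le> 0"
      unfolding Re_divide_of_real using \<open>x \<noteq> 0\<close> by (simp add: divide_le_0_iff)
    moreover have "\<omega> * q = norm q"
      using \<open>q \<noteq> 0\<close> complex_norm_square[of q]
      by (simp add: \<omega>_def field_simps power2_eq_square)
    ultimately have "norm q \<le> Re q"
      by (simp add: left_diff_distrib del: times_complex.sel)
    then show ?thesis by (simp add: q_def)
  next
    case True
    moreover have "quad_form P 0 = 0" by (simp add: quad_form_def)
    ultimately show ?thesis by auto
  qed
  have "quad_form P x \<in> \<real>" for x
  proof -
    have "\<bar>Re (quad_form P x)\<bar> = norm (quad_form P x)"
      using quad[of x] abs_Re_le_cmod[of "quad_form P x"] by linarith
    then show ?thesis
      by (simp add: cmod_def complex_is_Real_iff real_sqrt_abs[symmetric] del: real_sqrt_abs)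
  qed
  moreover have "0 \<le> Re (quad_form P x)" for x
    using quad[of x] norm_ge_zero[of "quad_form P x"] by linarith
  ultimately have "pos_semidef P"
    by (simp add: pos_semidef_def hermitian_mat_if_quad_form_real)
  with U show thesis unfolding P_def by (rule that)
qed

section \<open>Uniqueness of the positive semidefinite square root\<close>

text \<open>At a zero of its quadratic form, a positive semidefinite \<open>P\<close> has a minimum, so the derivative
  of the form vanishes there. In the direction \<open>y = P x\<close> this derivative is twice
  \<open>y \<bullet> y\<close>; a small negative step makes the form negative unless \<open>y = 0\<close>.\<close>

lemma pos_semidef_quad_form_eq_0:
  assumes "pos_semidef P" and "Re (quad_form P x) = 0"
  shows "P *v x = 0"
proof (rule ccontr)
  define y where "y = P *v x"
  assume "P *v x \<noteq> 0"
  then have "y \<bullet> y > 0" by (simp add: y_def)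
  have xPy: "(\<Sum>i\<in>UNIV. cnj (x $ i) * (P *v y) $ i) = (\<Sum>j\<in>UNIV. cnj (y $ j) * y $ j)"
    using assms(1) conj_transpose_adjoint[of x P y]
    by (simp add: pos_semidef_def hermitian_mat_def y_def)
  have yy: "Re (\<Sum>j\<in>UNIV. cnj (y $ j) * y $ j) = y \<bullet> y"
    by (simp add: inner_vec_def inner_complex_def)
  have expand: "Re (quad_form P (x + complex_of_real t *s y))
      = 2 * t * (y \<bullet> y) + t\<^sup>2 * Re (quad_form P y)" for t
  proof -
    have "quad_form P (x + complex_of_real t *s y)
        = quad_form P x + t * (\<Sum>i\<in>UNIV. cnj (x $ i) * (P *v y) $ i)
          + t * (\<Sum>i\<in>UNIV. cnj (y $ i) * (P *v x) $ i) + t\<^sup>2 * quad_form P y"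
      by (simp add: quad_form_def matrix_vector_right_distrib vector_scalar_commute
          algebra_simps sum.distrib sum_distrib_left power2_eq_square)
    also have "\<dots> = quad_form P x + 2 * t * (\<Sum>j\<in>UNIV. cnj (y $ j) * y $ j) + t\<^sup>2 * quad_form P y"
      unfolding xPy by (simp add: y_def)
    finally show ?thesis
      using assms(2) yy by simp
  qed
  define r where "r = Re (quad_form P y)"
  have "r \<ge> 0" using assms(1) by (simp add: r_def pos_semidef_def)
  \<comment> \<open>The choice \<open>- (y \<bullet> y) / r\<close> minimises the parabola if \<open>r > 0\<close>; \<open>r + 1\<close> avoids a division by zero.\<close>
  define t where "t = - (y \<bullet> y) / (r + 1)"
  have t: "y \<bullet> y = - t * (r + 1)" "t \<noteq> 0"
    using \<open>r \<ge> 0\<close> \<open>y \<bullet> y > 0\<close> by (auto simp: t_def)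
  have "0 \<le> Re (quad_form P (x + complex_of_real t *s y))"
    using assms(1) by (simp add: pos_semidef_def)
  also have "\<dots> = 2 * t * (y \<bullet> y) + t\<^sup>2 * r"
    unfolding expand r_def ..
  also have "\<dots> = - (t\<^sup>2 * (r + 2))"
    unfolding t(1) by (simp add: algebra_simps power2_eq_square)
  also have "\<dots> < 0"
    using \<open>t \<noteq> 0\<close> \<open>r \<ge> 0\<close> by simp
  finally show False by simp
qed

lemma pos_semidef_trace_nonneg:
  assumes "pos_semidef P"
  shows "0 \<le> Re (trace (conj_transpose D ** P ** D))"
  unfolding trace_conj_transpose_mult_mult Re_sum
  by (rule sum_nonneg) (use assms in \<open>simp add: pos_semidef_def\<close>)

lemma pos_semidef_trace_eq_0:
  assumes "pos_semidef P" and "Re (trace (conj_transpose D ** P ** D)) = 0"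
  shows "P ** D = 0"
proof -
  have nonneg: "0 \<le> Re (quad_form P x)" for x
    using assms(1) by (simp add: pos_semidef_def)
  have "Re (quad_form P (column j D)) = 0" for j
    using assms(2) unfolding trace_conj_transpose_mult_mult Re_sum
    by (subst (asm) sum_nonneg_eq_0_iff) (use nonneg in auto)
  then have "P *v column j D = 0" for j
    using assms(1) pos_semidef_quad_form_eq_0 by blast
  then show ?thesis
    by (simp add: vec_eq_iff matrix_matrix_mult_def matrix_vector_mult_def column_def)
qed

text \<open>Since \<open>P\<close> and \<open>Q\<close> need not commute, \<open>P P - Q Q\<close> does not factor as \<open>(P - Q) (P + Q)\<close>; but
  the symmetrised product \<open>(P + Q) D + D (P + Q)\<close> with \<open>D = P - Q\<close> is \<open>2 (P P - Q Q) = 0\<close>, and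
  under the trace this anticommutation is enough.\<close>

lemma pos_semidef_sqrt_unique:
  fixes P Q :: "complex^'n^'n"
  assumes P: "pos_semidef P" and Q: "pos_semidef Q" and eq: "P ** P = Q ** Q"
  shows "P = Q"
proof -
  define D where "D = P - Q"
  have D: "conj_transpose D = D"
    using P Q by (simp add: D_def conj_transpose_diff pos_semidef_def hermitian_mat_def)
  have anti: "P ** D + Q ** D = - (D ** P + D ** Q)"
    using eq by (simp add: D_def matrix_diff_ldistrib matrix_diff_rdistrib)
  have neg: "trace (D ** (- M)) = - trace (D ** M)" for M
    by (simp add: trace_def matrix_matrix_mult_def sum_negf)
  have "trace (D ** P ** D) + trace (D ** Q ** D) = trace (D ** (P ** D + Q ** D))"
    by (simp add: trace_add matrix_add_ldistrib matrix_mul_assoc)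
  also have "\<dots> = - trace (D ** (D ** P + D ** Q))"
    unfolding anti by (rule neg)
  also have "\<dots> = - (trace (D ** (D ** P)) + trace (D ** (D ** Q)))"
    by (simp add: trace_add matrix_add_ldistrib)
  also have "\<dots> = - (trace (D ** P ** D) + trace (D ** Q ** D))"
    by (simp add: trace_mul_sym[of D "D ** _"])
  finally have "Re (trace (D ** P ** D)) + Re (trace (D ** Q ** D)) = 0"
    by (auto dest: arg_cong[of _ _ Re])
  moreover have "0 \<le> Re (trace (D ** P ** D))" "0 \<le> Re (trace (D ** Q ** D))"
    using pos_semidef_trace_nonneg[OF P, of D] pos_semidef_trace_nonneg[OF Q, of D] by (simp_all add: D)
  ultimately have "P ** D = 0" "Q ** D = 0"
    using pos_semidef_trace_eq_0[OF P, of D] pos_semidef_trace_eq_0[OF Q, of D] by (auto simp: D)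
  then have "conj_transpose D ** D = 0"
    unfolding D by (subst (1) D_def) (simp add: matrix_diff_rdistrib)
  then show ?thesis
    using conj_transpose_mult_eq_0[of D] by (simp add: D_def)
qed

lemma psd_sqrt_square: "pos_semidef P \<Longrightarrow> psd_sqrt (P ** P) = P"
  unfolding psd_sqrt_def by (rule the_equality) (auto intro: pos_semidef_sqrt_unique)

lemma psd_sqrt_gram_left:
  obtains U where "U \<in> unitary_group" and "psd_sqrt (conj_transpose Z ** Z) = U ** Z"
proof -
  obtain V where V: "V \<in> unitary_group" and P: "pos_semidef (conj_transpose V ** Z)"
    by (rule unitary_polar_factor)
  have "(conj_transpose V ** Z) ** (conj_transpose V ** Z)
      = conj_transpose (conj_transpose V ** Z) ** (conj_transpose V ** Z)"
    using P by (simp add: pos_semidef_def hermitian_mat_def)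
  also have "\<dots> = conj_transpose Z ** (V ** conj_transpose V) ** Z"
    by (simp add: conj_transpose_mult matrix_mul_assoc)
  also have "\<dots> = conj_transpose Z ** Z"
    using V by (simp add: unitary_group_def)
  finally have "psd_sqrt (conj_transpose Z ** Z) = conj_transpose V ** Z"
    using psd_sqrt_square[OF P] by simp
  with conj_transpose_in_unitary_group[OF V] show thesis by (rule that)
qed

text \<open>The left version for \<open>Z\<^sup>*\<close> produces \<open>V\<^sup>* Z\<^sup>*\<close>, which is Hermitian and hence equal to \<open>Z V\<close>.\<close>

lemma psd_sqrt_gram_right:
  obtains U where "U \<in> unitary_group" and "psd_sqrt (Z ** conj_transpose Z) = Z ** U"
proof -
  obtain V where V: "V \<in> unitary_group"
    and P: "pos_semidef (conj_transpose V ** conj_transpose Z)"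
    by (rule unitary_polar_factor)
  have ZV: "conj_transpose V ** conj_transpose Z = Z ** V"
    using P by (simp add: pos_semidef_def hermitian_mat_def conj_transpose_mult)
  have "(Z ** V) ** (Z ** V) = Z ** (V ** conj_transpose V) ** conj_transpose Z"
    by (subst (2) ZV[symmetric]) (simp add: matrix_mul_assoc)
  also have "\<dots> = Z ** conj_transpose Z"
    using V by (simp add: unitary_group_def)
  finally have "psd_sqrt (Z ** conj_transpose Z) = Z ** V"
    using psd_sqrt_square[OF P] unfolding ZV by simp
  with V show thesis by (rule that)
qed

section \<open>Unitary translations of the domain\<close>

lemma gram_unitary_left:
  assumes "U \<in> unitary_group"
  shows "conj_transpose (U ** Z) ** (U ** Z) = conj_transpose Z ** Z"
proof -
  have "conj_transpose (U ** Z) ** (U ** Z) = conj_transpose Z ** (conj_transpose U ** U) ** Z"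
    by (simp add: conj_transpose_mult matrix_mul_assoc)
  then show ?thesis using assms by (simp add: unitary_group_def)
qed

lemma gram_unitary_right:
  assumes "V \<in> unitary_group"
  shows "(Z ** V) ** conj_transpose (Z ** V) = Z ** conj_transpose Z"
  using gram_unitary_left[OF conj_transpose_in_unitary_group[OF assms], of "conj_transpose Z"]
  by (simp add: conj_transpose_mult)

lemma cartan_domain_I_unitary_left:
  "U \<in> unitary_group \<Longrightarrow> Z \<in> cartan_domain_I \<Longrightarrow> U ** Z \<in> cartan_domain_I"
  by (simp add: cartan_domain_I_def gram_unitary_left)

text \<open>Unlike on the left, \<open>Z\<^sup>* Z\<close> itself changes here, but only by a unitary congruence:
  \<open>I - (Z V)\<^sup>* (Z V) = V\<^sup>* (I - Z\<^sup>* Z) V\<close>.\<close>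

lemma cartan_domain_I_unitary_right:
  assumes V: "V \<in> unitary_group" and Z: "Z \<in> cartan_domain_I"
  shows "Z ** V \<in> cartan_domain_I"
proof -
  define M where "M = mat 1 - conj_transpose Z ** Z"
  have M: "pos_def M"
    using Z by (simp add: cartan_domain_I_def loewner_less_def M_def)
  have eq: "mat 1 - conj_transpose (Z ** V) ** (Z ** V) = conj_transpose V ** M ** V"
    using V by (simp add: M_def conj_transpose_mult matrix_diff_ldistrib matrix_diff_rdistrib
        matrix_mul_assoc unitary_group_def)
  have "V *v x \<noteq> 0" if "x \<noteq> 0" for x
  proof
    assume "V *v x = 0"
    then have "(conj_transpose V ** V) *v x = 0"
      by (simp flip: matrix_vector_mul_assoc)
    with that V show False by (simp add: unitary_group_def)
  qed
  then have "pos_def (conj_transpose V ** M ** V)"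
    using M by (simp add: pos_def_def hermitian_mat_def quad_form_congruence
        conj_transpose_mult matrix_mul_assoc)
  then show ?thesis
    by (simp add: cartan_domain_I_def loewner_less_def eq)
qed

theorem proposition3p8:
  fixes a :: "complex^'n^'n \<Rightarrow> complex"
  assumes "Linf_symbol a"
  shows
    "(((\<forall>Z\<in>cartan_domain_I. a Z = a (psd_sqrt (conj_transpose Z ** Z)))
          \<longrightarrow> left_unitary_invariant a) \<and>
      (left_unitary_invariant a \<longrightarrow>
          (\<forall>Z\<in>cartan_domain_I \<inter> general_linear. a Z = a (psd_sqrt (conj_transpose Z ** Z))))) \<and>
     (((\<forall>Z\<in>cartan_domain_I. a Z = a (psd_sqrt (Z ** conj_transpose Z)))
          \<longrightarrow> right_unitary_invariant a) \<and>
      (right_unitary_invariant a \<longrightarrow>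
          (\<forall>Z\<in>cartan_domain_I \<inter> general_linear. a Z = a (psd_sqrt (Z ** conj_transpose Z)))))"
proof (intro conjI impI)
  assume polar: "\<forall>Z\<in>cartan_domain_I. a Z = a (psd_sqrt (conj_transpose Z ** Z))"
  show "left_unitary_invariant a"
    unfolding left_unitary_invariant_def
    using polar by (metis cartan_domain_I_unitary_left gram_unitary_left)
next
  assume inv: "left_unitary_invariant a"
  show "\<forall>Z\<in>cartan_domain_I \<inter> general_linear. a Z = a (psd_sqrt (conj_transpose Z ** Z))"
    using inv unfolding left_unitary_invariant_def by (metis IntD1 psd_sqrt_gram_left)
next
  assume polar: "\<forall>Z\<in>cartan_domain_I. a Z = a (psd_sqrt (Z ** conj_transpose Z))"
  show "right_unitary_invariant a"
    unfolding right_unitary_invariant_def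
    using polar by (metis cartan_domain_I_unitary_right gram_unitary_right)
next
  assume inv: "right_unitary_invariant a"
  show "\<forall>Z\<in>cartan_domain_I \<inter> general_linear. a Z = a (psd_sqrt (Z ** conj_transpose Z))"
    using inv unfolding right_unitary_invariant_def by (metis IntD1 psd_sqrt_gram_right)
qed

end
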